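(* For each pair $(n,p)\in\{(63,31),(91,3),(92,7),(93,23)\}$, there does not exist an almost $p$-ary perfect sequence of period $n+1$.
   Context: For a prime $p$, an almost $p$-ary sequence of period $N$ is a sequence $\underline{a}=(a_0,a_1,\ldots)$ of complex numbers of period $N$ (so $a_{i+N}=a_i$) with $a_0=0$ and with $a_1,\ldots,a_{N-1}$ all powers of a primitive $p$-th root of unity $\zeta_p\in\mathbb{C}$. Its autocorrelation function is $C_{\underline{a}}(t)=\sum_{i=0}^{N-1}a_i\overline{a_{i+t}}$ for $0\le t\le N-1$. The sequence is perfect if $C_{\underline{a}}(t)=0$ for all $1\le t\le N-1$. *)

theory Defs
  imports "HOL-Analysis.Analysis"
begin

definition primitive_root_of_unity :: "nat \<Rightarrow> complex \<Rightarrow> bool" where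
  "primitive_root_of_unity m z \<longleftrightarrow> m > 0 \<and> z ^ m = 1 \<and> (\<forall>k. 0 < k \<and> k < m \<longrightarrow> z ^ k \<noteq> 1)"

(* N is required to be a period, not the least one; for an almost p-ary sequence it is
   automatically the least, since its zeros are exactly the multiples of N. *)
definition almost_ary_sequence :: "nat \<Rightarrow> nat \<Rightarrow> (nat \<Rightarrow> complex) \<Rightarrow> bool" where
  "almost_ary_sequence p N a \<longleftrightarrow>
     (\<forall>i. a (i + N) = a i) \<and> a 0 = 0 \<and>
     (\<exists>\<zeta>. primitive_root_of_unity p \<zeta> \<and> (\<forall>i\<in>{1..<N}. \<exists>k::nat. a i = \<zeta> ^ k))"

definition autocorrelation :: "nat \<Rightarrow> (nat \<Rightarrow> complex) \<Rightarrow> nat \<Rightarrow> complex" where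
  "autocorrelation N a t = (\<Sum>i<N. a i * cnj (a (i + t)))"

definition perfect_sequence :: "nat \<Rightarrow> (nat \<Rightarrow> complex) \<Rightarrow> bool" where
  "perfect_sequence N a \<longleftrightarrow> (\<forall>t\<in>{1..<N}. autocorrelation N a t = 0)"

end

theory Submission
  imports Defs "HOL-Computational_Algebra.Polynomial_Factorial" "HOL-Number_Theory.Cong"
begin

text \<open>Let \<open>N = n + 1\<close> and let \<open>a\<close> be a perfect almost \<open>p\<close>-ary sequence of period \<open>N\<close>. The nonzero terms
of \<open>a\<close> form a relative difference set in the product of the integers modulo \<open>N\<close> and modulo \<open>p\<close>, and
the proof is a multiplier argument. Suppose that a number \<open>t\<close> is congruent modulo \<open>p * N\<close> to a power of
every prime in a set \<open>R\<close> of prime divisors of \<open>n\<close>, that \<open>p\<close> divides \<open>n - 1\<close>, and that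
\<open>n - 1 < p * \<Prod>R\<close>. The claim is that \<open>a (t * j)\<close> is a constant times \<open>a j ^ t\<close>
(\<open>multiplier\<close>).

To see this, consider \<open>E s = \<Sum>i<N. a i ^ t * cnj (a (t * i + s))\<close>. For each \<open>r \<in> R\<close> the
Frobenius congruence together with perfection shows that \<open>E s\<close> is divisible by \<open>r\<close> in \<open>\<int>[\<zeta>]\<close>
(\<open>prime_divides_twisted_correlation\<close>). Since \<open>1 + \<zeta> + \<dots> + \<zeta> ^ (p - 1) = 0\<close> generates all
integer relations between these powers of \<open>\<zeta>\<close> (\<open>root_of_unity_relation_const\<close>), the numbers of
summands of \<open>E s\<close> that equal a given \<open>\<zeta> ^ c\<close> are all congruent modulo \<open>\<Prod>R\<close>.
For \<open>s \<noteq> 0\<close> there are only \<open>n - 1\<close> nonzero summands, and this number is a multiple of \<open>p\<close> too small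
to be split into \<open>p\<close> congruent numbers that are not all equal, hence \<open>E s = 0\<close>
(\<open>twisted_correlation_eq_0\<close>). The shifts of \<open>a\<close> being orthogonal, the claim follows.

For \<open>(63, 31)\<close>, \<open>(92, 7)\<close> and \<open>(93, 23)\<close> the primes \<open>3\<close>, \<open>23\<close> and \<open>31\<close> serve as \<open>t\<close>. In each
case \<open>t ^ L\<close> is \<open>1\<close> modulo \<open>N\<close> but not modulo \<open>p\<close> for a suitable \<open>L\<close>; iterating the
multiplier \<open>L\<close> times forces all nonzero terms of \<open>a\<close> to be equal, which contradicts perfection
(\<open>no_multiplier_of_wrong_order\<close>). For \<open>(91, 3)\<close> the multiplier is \<open>49\<close>, a power of both \<open>7\<close> and
\<open>13\<close> modulo \<open>276\<close>. It makes the sum of \<open>a\<close> over the multiples of \<open>4\<close> equal to \<open>11\<close> times a sum of two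
cube roots of unity, too large for the squared norms of the sums over the classes modulo
\<open>4\<close> to add up to \<open>91\<close> (\<open>no_perfect_almost_ternary_92\<close>).\<close>

section \<open>Eisenstein criterion\<close>

text \<open>Let \<open>i\<close> be the least index with \<open>q\<close> not dividing the \<open>i\<close>-th coefficient of \<open>g\<close>. Modulo \<open>q\<close> the
\<open>i\<close>-th coefficient of \<open>g * h\<close> is that coefficient times the constant term of \<open>h\<close>, hence nonzero. So
\<open>i\<close> is already the degree of the product, which leaves no degree for \<open>h\<close>.\<close>

lemma eisenstein_aux:
  fixes g h :: "'a :: idom poly"
  assumes q: "prime_elem q"
    and lead: "\<not> q dvd lead_coeff (g * h)"
    and low: "\<And>i. i < degree (g * h) \<Longrightarrow> q dvd coeff (g * h) i"
    and h0: "\<not> q dvd coeff h 0"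
  shows "degree h = 0"
proof -
  have gh: "g * h \<noteq> 0" using lead by auto
  have "\<not> q dvd lead_coeff g" using lead by (auto simp: lead_coeff_mult)
  define i where "i = (LEAST i. \<not> q dvd coeff g i)"
  have i: "\<not> q dvd coeff g i" and i_le: "i \<le> degree g"
    unfolding i_def using \<open>\<not> q dvd lead_coeff g\<close> by (rule LeastI, rule Least_le)
  have less: "q dvd coeff g j" if "j < i" for j
    using not_less_Least[of j "\<lambda>i. \<not> q dvd coeff g i"] that unfolding i_def by blast
  have "coeff (g * h) i = (\<Sum>j<i. coeff g j * coeff h (i - j)) + coeff g i * coeff h 0"
    by (simp add: coeff_mult flip: lessThan_Suc_atMost)
  moreover have "q dvd (\<Sum>j<i. coeff g j * coeff h (i - j))"
    by (intro dvd_sum dvd_mult2 less) auto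
  moreover have "\<not> q dvd coeff g i * coeff h 0"
    using q i h0 prime_elem_dvd_mult_iff by blast
  ultimately have "\<not> q dvd coeff (g * h) i"
    by (metis dvd_add_right_iff)
  hence "degree (g * h) \<le> i" using low not_le by blast
  moreover have "degree (g * h) = degree g + degree h"
    using gh by (intro degree_mult_eq) auto
  ultimately show ?thesis using i_le by linarith
qed

text \<open>Since \<open>q\<^sup>2\<close> does not divide the constant term of the product, one of the two constant terms is not
divisible by \<open>q\<close>.\<close>

lemma eisenstein:
  fixes g h :: "'a :: idom poly"
  assumes q: "prime_elem q"
    and lead: "\<not> q dvd lead_coeff (g * h)"
    and low: "\<And>i. i < degree (g * h) \<Longrightarrow> q dvd coeff (g * h) i"
    and const: "\<not> q ^ 2 dvd coeff (g * h) 0"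
  shows "degree g = 0 \<or> degree h = 0"
proof -
  have "\<not> (q dvd coeff g 0 \<and> q dvd coeff h 0)"
    using const mult_dvd_mono[of q "coeff g 0" q "coeff h 0"]
    by (auto simp: coeff_mult power2_eq_square)
  thus ?thesis
    using eisenstein_aux[OF q lead low] eisenstein_aux[of q h g] q lead low
    by (auto simp: mult.commute)
qed

section \<open>Integer relations between the powers of a root of unity\<close>

text \<open>The additive map that replaces the monomial of degree \<open>k\<close> by the weight \<open>w k\<close>. With
\<open>w k = x ^ k\<close> it is evaluation at \<open>x\<close>; with other weights it reads off correlations of a sequence.\<close>

definition weigh :: "int poly \<Rightarrow> (nat \<Rightarrow> 'a :: comm_ring_1) \<Rightarrow> 'a" where
  "weigh f w = (\<Sum>k\<le>degree f. of_int (coeff f k) * w k)"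

lemma weigh_le: "degree f \<le> M \<Longrightarrow> weigh f w = (\<Sum>k\<le>M. of_int (coeff f k) * w k)"
  unfolding weigh_def by (rule sum.mono_neutral_left) (auto simp: coeff_eq_0)

lemma weigh_0 [simp]: "weigh 0 w = 0"
  by (simp add: weigh_def)

lemma weigh_add: "weigh (f + g) w = weigh f w + weigh g w"
proof -
  let ?M = "max (degree f) (degree g)"
  have "degree (f + g) \<le> ?M" by (rule degree_add_le_max)
  thus ?thesis
    by (simp add: weigh_le[of _ ?M] sum.distrib algebra_simps)
qed

lemma weigh_sum: "weigh (\<Sum>i\<in>A. f i) w = (\<Sum>i\<in>A. weigh (f i) w)"
  by (induction A rule: infinite_finite_induct) (auto simp: weigh_add)

lemma weigh_monom [simp]: "weigh (monom c k) w = of_int c * w k"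
proof -
  have "weigh (monom c k) w = (\<Sum>j\<le>k. if k = j then of_int c * w j else 0)"
    unfolding weigh_le[OF degree_monom_le] by (intro sum.cong) auto
  thus ?thesis by simp
qed

lemma weigh_smult: "weigh (smult c f) w = of_int c * weigh f w"
  unfolding weigh_le[OF degree_smult_le] by (simp add: weigh_def sum_distrib_left mult_ac)

lemma weigh_mult:
  "weigh (f * g) w = (\<Sum>k\<le>degree g. of_int (coeff g k) * weigh f (\<lambda>j. w (j + k)))"
proof -
  have *: "weigh (f * monom c k) w = of_int c * weigh f (\<lambda>j. w (j + k))" for c k
  proof -
    have "f * monom c k = (\<Sum>j\<le>degree f. monom (coeff f j * c) (j + k))"
      by (subst poly_as_sum_of_monoms[of f, symmetric]) (simp add: sum_distrib_right mult_monom)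
    thus ?thesis
      by (simp only: weigh_sum weigh_monom) (simp add: weigh_def sum_distrib_left mult_ac)
  qed
  have "f * g = (\<Sum>k\<le>degree g. f * monom (coeff g k) k)"
    by (subst poly_as_sum_of_monoms[of g, symmetric]) (simp add: sum_distrib_left)
  thus ?thesis by (simp only: weigh_sum *)
qed

lemma weigh_power_mult:
  "weigh (f * g) (\<lambda>k. x ^ k) = weigh f (\<lambda>k. x ^ k) * weigh g (\<lambda>k. x ^ k)"
proof -
  have "weigh f (\<lambda>j. x ^ (j + k)) = weigh f (\<lambda>k. x ^ k) * x ^ k" for k
    by (simp add: weigh_def power_add sum_distrib_left mult_ac)
  thus ?thesis
    by (simp add: weigh_mult) (simp add: weigh_def[of g] sum_distrib_left mult_ac)
qed

lemma weigh_power_pCons: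
  "weigh (pCons c f) (\<lambda>k. x ^ k) = of_int c + x * weigh f (\<lambda>k. x ^ k)"
proof -
  have "pCons c f = monom c 0 + monom 1 1 * f"
    by (simp add: monom_0 monom_Suc)
  thus ?thesis by (simp add: weigh_add weigh_power_mult)
qed

text \<open>A prime factor \<open>g\<close> of a relation of least degree still vanishes at \<open>x\<close>. Pseudo-division
of any relation \<open>f\<close> by \<open>g\<close> leaves remainder \<open>0\<close>, so \<open>g\<close> divides a nonzero constant times \<open>f\<close>; as
\<open>g\<close> is prime and not constant, it divides \<open>f\<close> itself.\<close>

lemma prime_generator_of_relations:
  fixes x :: "'a :: field_char_0"
  assumes "F \<noteq> 0" "weigh F (\<lambda>k. x ^ k) = 0"
  obtains g :: "int poly" where "prime_elem g" "weigh g (\<lambda>k. x ^ k) = 0"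
    "\<And>f. weigh f (\<lambda>k. x ^ k) = 0 \<Longrightarrow> g dvd f"
proof -
  define Z where "Z = (\<lambda>f :: int poly. f \<noteq> 0 \<and> weigh f (\<lambda>k. x ^ k) = 0)"
  have "Z F" using assms by (simp add: Z_def)
  define h where "h = (ARG_MIN degree f. Z f)"
  have h: "Z h" and hmin: "\<And>f. Z f \<Longrightarrow> degree h \<le> degree f"
    unfolding h_def using \<open>Z F\<close> by (auto intro: arg_min_natI arg_min_nat_le)
  have "normalize (prod_mset (prime_factorization h)) = normalize h"
    using h by (intro prod_mset_prime_factorization_weak) (simp add: Z_def)
  hence "h dvd prod_mset (prime_factorization h)"
    by (simp add: associated_iff_dvd)
  hence "weigh (prod_mset (prime_factorization h)) (\<lambda>k. x ^ k) = 0"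
    using h by (auto simp: Z_def weigh_power_mult)
  moreover have "\<exists>g\<in>#A. weigh g (\<lambda>k. x ^ k) = 0"
    if "weigh (prod_mset A) (\<lambda>k. x ^ k) = 0" for A :: "int poly multiset"
    using that by (induction A) (auto simp: weigh_power_mult weigh_def[of 1])
  ultimately obtain g where g: "g \<in># prime_factorization h" "weigh g (\<lambda>k. x ^ k) = 0"
    by blast
  have pg: "prime_elem g" and "g dvd h" "g \<noteq> 0"
    using g(1) by (auto simp: in_prime_factors_iff)
  hence gmin: "degree g \<le> degree f" if "Z f" for f
    using hmin[OF that] dvd_imp_degree_le[of g h] h by (auto simp: Z_def)
  have nonconst: "degree g \<noteq> 0"
  proof
    assume "degree g = 0"
    then obtain c where "g = [:c:]" by (auto elim: degree_eq_zeroE)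
    with g(2) \<open>g \<noteq> 0\<close> show False by (simp add: weigh_def)
  qed
  show ?thesis
  proof (rule that[OF pg g(2)])
    fix f assume f: "weigh f (\<lambda>k. x ^ k) = 0"
    obtain q r where qr: "pseudo_divmod f g = (q, r)" by fastforce
    define c where "c = lead_coeff g ^ (Suc (degree f) - degree g)"
    have eq: "smult c f = g * q + r" and r: "r = 0 \<or> degree r < degree g"
      using pseudo_divmod[OF \<open>g \<noteq> 0\<close> qr] by (auto simp: c_def)
    have "weigh r (\<lambda>k. x ^ k) = 0"
      using arg_cong[OF eq, of "\<lambda>f. weigh f (\<lambda>k. x ^ k)"] f g(2)
      by (simp add: weigh_smult weigh_add weigh_power_mult)
    hence "r = 0" using r gmin[of r] by (force simp: Z_def)
    hence "g dvd [:c:] * f" using eq by simp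
    hence "g dvd [:c:] \<or> g dvd f" using pg prime_elem_dvd_mult_iff by blast
    moreover have "\<not> g dvd [:c:]"
    proof
      assume "g dvd [:c:]"
      moreover have "c \<noteq> 0" using \<open>g \<noteq> 0\<close> by (simp add: c_def)
      ultimately show False using nonconst dvd_imp_degree_le[of g "[:c:]"] by simp
    qed
    ultimately show "g dvd f" by blast
  qed
qed

text \<open>The \<open>p\<close>-th cyclotomic polynomial is irreducible: at \<open>\<zeta> - 1\<close> it becomes
\<open>((X + 1) ^ p - 1) / X\<close>, which is an Eisenstein polynomial for \<open>p\<close>.\<close>

lemma degree_relation_root_of_unity:
  fixes \<zeta> :: "'a :: field_char_0"
  assumes p: "prime p" and \<zeta>: "\<zeta> ^ p = 1" "\<zeta> \<noteq> 1"
    and f: "f \<noteq> 0" "weigh f (\<lambda>k. \<zeta> ^ k) = 0"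
  shows "p - 1 \<le> degree f"
proof -
  have p1: "p > 1" using p prime_gt_1_nat by blast
  \<comment> \<open>\<open>\<Psi>\<close> is \<open>((X + 1) ^ p - 1) / X\<close>.\<close>
  define \<Psi> :: "int poly" where "\<Psi> = (\<Sum>k<p. monom (int (p choose Suc k)) k)"
  have coeff: "coeff \<Psi> k = (if k < p then int (p choose Suc k) else 0)" for k
    by (simp add: \<Psi>_def coeff_sum)
  have deg: "degree \<Psi> = p - 1"
    using p1 by (intro antisym degree_le le_degree) (auto simp: coeff)
  have "(\<zeta> - 1) * weigh \<Psi> (\<lambda>k. (\<zeta> - 1) ^ k) = (\<Sum>k<p. of_nat (p choose Suc k) * (\<zeta> - 1) ^ Suc k)"
    by (simp add: \<Psi>_def weigh_sum sum_distrib_left mult_ac)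
  also have "\<dots> = (\<Sum>k\<le>p. of_nat (p choose k) * (\<zeta> - 1) ^ k) - 1"
    by (simp add: sum.atMost_shift)
  also have "\<dots> = ((\<zeta> - 1) + 1) ^ p - 1"
    by (subst binomial_ring) simp
  finally have root: "weigh \<Psi> (\<lambda>k. (\<zeta> - 1) ^ k) = 0" using \<zeta> by simp
  have "\<Psi> \<noteq> 0" using deg coeff[of 0] p1 by auto
  obtain g where g: "prime_elem g" "weigh g (\<lambda>k. (\<zeta> - 1) ^ k) = 0"
    and gen: "\<And>f. weigh f (\<lambda>k. (\<zeta> - 1) ^ k) = 0 \<Longrightarrow> g dvd f"
    using prime_generator_of_relations[OF \<open>\<Psi> \<noteq> 0\<close> root] by blast
  obtain h where h: "\<Psi> = g * h" using gen[OF root] by auto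
  have "degree g = 0 \<or> degree h = 0"
  proof (rule eisenstein[of "int p"])
    show "prime_elem (int p)" using p by auto
    show "\<not> int p dvd lead_coeff (g * h)"
      using p1 by (simp add: deg coeff flip: h)
    show "int p dvd coeff (g * h) i" if "i < degree (g * h)" for i
      using that p by (auto simp: deg coeff intro!: dvd_choose_prime simp flip: h)
    show "\<not> (int p)\<^sup>2 dvd coeff (g * h) 0"
      using p1 by (auto simp: coeff power2_eq_square simp flip: h dest: zdvd_imp_le)
  qed
  moreover have "degree g \<noteq> 0"
  proof
    assume "degree g = 0"
    then obtain c where "g = [:c:]" by (auto elim: degree_eq_zeroE)
    with g show False by (auto simp add: weigh_def)
  qed
  ultimately have "degree g = p - 1"
    using h deg \<open>\<Psi> \<noteq> 0\<close> by (auto simp: degree_mult_eq)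
  \<comment> \<open>Substituting \<open>X + 1\<close> turns relations of \<open>\<zeta>\<close> into relations of \<open>\<zeta> - 1\<close> of the same degree.\<close>
  define f' where "f' = pcompose f [:1, 1:]"
  have "degree f' = degree f" by (simp add: f'_def degree_pcompose)
  have "weigh f' (\<lambda>k. (\<zeta> - 1) ^ k) = weigh f (\<lambda>k. \<zeta> ^ k)"
    unfolding f'_def
  proof (induction f)
    case (pCons c f)
    have "weigh [:1, 1:] (\<lambda>k. (\<zeta> - 1) ^ k) = \<zeta>"
      by (simp add: weigh_def)
    moreover have "weigh [:c:] (\<lambda>k. (\<zeta> - 1) ^ k) = of_int c"
      by (simp add: weigh_def)
    ultimately show ?case
      unfolding pcompose_pCons weigh_add weigh_power_mult weigh_power_pCons pCons.IH by simp
  qed simp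
  hence "g dvd f'" using f gen by simp
  moreover have "f' \<noteq> 0" using f by (auto simp: f'_def pcompose_eq_0)
  ultimately show ?thesis
    using dvd_imp_degree_le[of g f'] \<open>degree f' = degree f\<close> \<open>degree g = p - 1\<close> by simp
qed

text \<open>Subtracting a multiple of \<open>1 + \<zeta> + \<dots> + \<zeta> ^ (p - 1) = 0\<close> kills the coefficient of
\<open>\<zeta> ^ (p - 1)\<close>; what is left has degree below \<open>p - 1\<close> and must vanish identically.\<close>

lemma root_of_unity_relation_const:
  fixes \<zeta> :: "'a :: field_char_0" and d :: "nat \<Rightarrow> int"
  assumes p: "prime p" and \<zeta>: "\<zeta> ^ p = 1" "\<zeta> \<noteq> 1"
    and d: "(\<Sum>j<p. of_int (d j) * \<zeta> ^ j) = 0" and "i < p" "j < p"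
  shows "d i = d j"
proof -
  have p1: "p > 1" using p prime_gt_1_nat by blast
  have geom: "(\<Sum>j<p. \<zeta> ^ j) = 0"
    using \<zeta> by (simp add: geometric_sum)
  define f :: "int poly" where "f = (\<Sum>j<p. monom (d j - d (p - 1)) j)"
  have coeff: "coeff f j = (if j < p then d j - d (p - 1) else 0)" for j
    by (simp add: f_def coeff_sum)
  have "degree f \<le> p - 2"
  proof (rule degree_le, intro allI impI)
    fix j assume "p - 2 < j"
    hence "j = p - 1 \<or> \<not> j < p" using p1 by linarith
    thus "coeff f j = 0" by (auto simp: coeff)
  qed
  moreover have "weigh f (\<lambda>k. \<zeta> ^ k) = (\<Sum>j<p. of_int (d j) * \<zeta> ^ j) - of_int (d (p - 1)) * (\<Sum>j<p. \<zeta> ^ j)"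
    by (simp add: f_def weigh_sum algebra_simps sum_subtractf sum_distrib_left sum_distrib_right)
  ultimately have "f = 0"
    using degree_relation_root_of_unity[OF p \<zeta>, of f] p1 d geom by force
  hence "d k = d (p - 1)" if "k < p" for k
    using coeff[of k] that by simp
  from this[of i] this[of j] show ?thesis using \<open>i < p\<close> \<open>j < p\<close> by simp
qed

section \<open>Frobenius modulo a prime\<close>

lemma dvd_freshmans_dream:
  fixes x y :: "'a :: comm_ring_1"
  assumes r: "prime r"
  shows "of_nat r dvd (x + y) ^ r - (x ^ r + y ^ r)"
proof -
  have r1: "r > 1" using r prime_gt_1_nat by blast
  let ?f = "\<lambda>k. of_nat (r choose k) * x ^ k * y ^ (r - k)"
  have split: "{..r} = {1..<r} \<union> {0, r}" using r1 by auto
  have "(x + y) ^ r = sum ?f {..r}" by (rule binomial_ring)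
  also have "\<dots> = sum ?f {1..<r} + (x ^ r + y ^ r)"
    unfolding split using r1 by (subst sum.union_disjoint) auto
  finally have "(x + y) ^ r - (x ^ r + y ^ r) = sum ?f {1..<r}" by simp
  moreover have "of_nat r dvd ?f k" if "k \<in> {1..<r}" for k
  proof -
    have "r dvd (r choose k)" using that r r1 by (intro dvd_choose_prime) auto
    hence "(of_nat r :: 'a) dvd of_nat (r choose k)" by (auto simp: dvd_def)
    thus ?thesis by (intro dvd_mult2)
  qed
  ultimately show ?thesis by (simp only:) (rule dvd_sum)
qed

lemma dvd_freshmans_dream_sum:
  fixes f :: "'b \<Rightarrow> 'a :: comm_ring_1"
  assumes r: "prime r"
  shows "of_nat r dvd sum f A ^ r - (\<Sum>i\<in>A. f i ^ r)"
proof (induction A rule: infinite_finite_induct)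
  case (insert x A)
  have "sum f (insert x A) ^ r - (\<Sum>i\<in>insert x A. f i ^ r)
      = ((f x + sum f A) ^ r - (f x ^ r + sum f A ^ r)) + (sum f A ^ r - (\<Sum>i\<in>A. f i ^ r))"
    using insert.hyps by simp
  thus ?case
    using dvd_add[OF dvd_freshmans_dream[OF r, of "f x" "sum f A"] insert.IH] by (simp only:)
qed (use r prime_gt_0_nat[OF r] in \<open>auto simp: power_0_left\<close>)

lemma dvd_freshmans_dream_sum_power:
  fixes f :: "'b \<Rightarrow> 'a :: comm_ring_1"
  assumes r: "prime r"
  shows "of_nat r dvd sum f A ^ (r ^ e) - (\<Sum>i\<in>A. f i ^ (r ^ e))"
proof (induction e)
  case (Suc e)
  let ?X = "sum f A ^ (r ^ e)" and ?Y = "\<Sum>i\<in>A. f i ^ (r ^ e)"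
  have "?X - ?Y dvd ?X ^ r - ?Y ^ r"
    unfolding power_diff_sumr2[of ?X r ?Y] by (rule dvd_triv_left)
  hence "of_nat r dvd ?X ^ r - ?Y ^ r" using Suc.IH dvd_trans by blast
  moreover have "of_nat r dvd ?Y ^ r - (\<Sum>i\<in>A. (f i ^ (r ^ e)) ^ r)"
    by (rule dvd_freshmans_dream_sum[OF r])
  ultimately have "of_nat r dvd (?X ^ r - ?Y ^ r) + (?Y ^ r - (\<Sum>i\<in>A. (f i ^ (r ^ e)) ^ r))"
    by (rule dvd_add)
  thus ?case by (simp add: mult.commute flip: power_mult)
qed simp

section \<open>Periodic sums and congruences\<close>

lemma sum_shift_periodic:
  fixes f :: "nat \<Rightarrow> 'a :: comm_monoid_add"
  assumes per: "\<And>i. f (i + N) = f i"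
  shows "(\<Sum>i<N. f (i + s)) = (\<Sum>i<N. f i)"
proof (induction s)
  case (Suc s)
  have "(\<Sum>i<N. f (i + Suc s)) = (\<Sum>i<N. f (i + s))"
  proof (cases N)
    case (Suc M)
    have "f (M + Suc s) = f s" using per[of s] by (simp add: Suc add_ac)
    thus ?thesis
      unfolding Suc by (subst sum.lessThan_Suc, subst sum.lessThan_Suc_shift) (simp add: add.commute)
  qed simp
  thus ?case using Suc.IH by simp
qed simp

text \<open>Write \<open>F c = f + m * k c\<close> with a common remainder \<open>f < m\<close>. As \<open>p\<close> divides the total of the \<open>F c\<close>,
it divides the total of the \<open>k c\<close>; if that were nonzero, it would be at least \<open>p\<close> and the total of
the \<open>F c\<close> at least \<open>p * m\<close>.\<close>

lemma equal_of_cong_of_small_sum: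
  fixes F :: "nat \<Rightarrow> nat"
  assumes "prime p" "\<not> p dvd m"
    and cong: "\<And>c d. c < p \<Longrightarrow> d < p \<Longrightarrow> [F c = F d] (mod m)"
    and dvd: "p dvd (\<Sum>c<p. F c)" and less: "(\<Sum>c<p. F c) < p * m"
    and "c < p" "d < p"
  shows "F c = F d"
proof -
  have p0: "p > 0" using assms(1) prime_gt_0_nat by blast
  define f where "f = F 0 mod m"
  have m0: "m > 0" using less by (cases m) auto
  have F: "F c = f + m * (F c div m)" if "c < p" for c
    using cong[OF that p0] mod_mult_div_eq[of "F c" m] by (simp add: f_def cong_def)
  have "(\<Sum>c<p. F c) = (\<Sum>c<p. f + m * (F c div m))"
    using F by (intro sum.cong) auto
  also have "\<dots> = p * f + m * (\<Sum>c<p. F c div m)"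
    by (simp add: sum.distrib sum_distrib_left)
  finally have eq: "(\<Sum>c<p. F c) = p * f + m * (\<Sum>c<p. F c div m)" .
  with dvd have "p dvd m * (\<Sum>c<p. F c div m)"
    by (simp add: dvd_add_right_iff)
  hence "p dvd (\<Sum>c<p. F c div m)"
    using assms(1,2) prime_dvd_mult_iff by blast
  moreover have "(\<Sum>c<p. F c div m) < p"
  proof (rule ccontr)
    assume "\<not> ?thesis"
    hence "m * p \<le> m * (\<Sum>c<p. F c div m)" by (intro mult_le_mono2) simp
    hence "p * m \<le> (\<Sum>c<p. F c)" unfolding eq by (simp only: mult.commute trans_le_add2)
    with less show False by simp
  qed
  ultimately have "(\<Sum>c<p. F c div m) = 0" using dvd_imp_le by (metis gr0I not_le)
  hence "F c div m = 0" if "c < p" for c using that by simp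
  with F[OF \<open>c < p\<close>] F[OF \<open>d < p\<close>] assms show ?thesis by simp
qed

lemma bij_betw_affine_mod:
  fixes t s N :: nat
  assumes "coprime t N" "N > 0"
  shows "bij_betw (\<lambda>i. (t * i + s) mod N) {..<N} {..<N}"
proof -
  have "inj_on (\<lambda>i. (t * i + s) mod N) {..<N}"
  proof (rule inj_onI)
    fix i j assume ij: "i \<in> {..<N}" "j \<in> {..<N}" "(t * i + s) mod N = (t * j + s) mod N"
    hence "[t * i + s = t * j + s] (mod N)" by (simp add: cong_def)
    hence "[i = j] (mod N)"
      using assms(1) by (simp add: cong_add_rcancel_nat cong_mult_lcancel_nat)
    thus "i = j" using ij by (simp add: cong_def)
  qed
  moreover have "(\<lambda>i. (t * i + s) mod N) ` {..<N} \<subseteq> {..<N}" using assms by auto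
  ultimately show ?thesis
    using endo_inj_surj[of "{..<N}"] by (auto simp: bij_betw_def)
qed

lemma periodic_mod:
  fixes f :: "nat \<Rightarrow> 'a"
  assumes per: "\<And>i. f (i + N) = f i"
  shows "f (i mod N) = f i"
proof -
  have "f (j + N * k) = f j" for j k
  proof (induction k)
    case (Suc k)
    have "f (j + N * Suc k) = f (j + N * k + N)" by (simp add: algebra_simps)
    thus ?case using Suc.IH per by simp
  qed simp
  from this[of "i mod N" "i div N"] show ?thesis by simp
qed

section \<open>Perfect almost p-ary sequences\<close>

text \<open>The root of unity is part of the data, and nonzero residues are expressed as
\<open>\<not> N dvd i\<close>, so that every fact below holds at all indices.\<close>

locale perfect_almost_ary =
  fixes p N :: nat and \<zeta> :: complex and a :: "nat \<Rightarrow> complex"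
  assumes prime_p: "prime p" and zeta_pow_p: "\<zeta> ^ p = 1" and zeta_neq_1: "\<zeta> \<noteq> 1"
    and N_gt_2: "N > 2" and p_dvd: "p dvd N - 2" and coprime_p_N: "coprime p N"
    and period: "a (i + N) = a i" and a_0: "a 0 = 0"
    and a_power: "\<not> N dvd i \<Longrightarrow> \<exists>k. a i = \<zeta> ^ k"
    and perfect: "\<not> N dvd s \<Longrightarrow> autocorrelation N a s = 0"
begin

lemma p_gt_1: "p > 1"
  using prime_p prime_gt_1_nat by blast

lemma norm_zeta: "norm \<zeta> = 1"
proof -
  have "norm \<zeta> ^ p = 1" using zeta_pow_p by (metis norm_one norm_power)
  thus ?thesis using p_gt_1 power_eq_imp_eq_base[of "norm \<zeta>" p 1] by simp
qed

lemma cnj_zeta_power: "cnj (\<zeta> ^ k) = \<zeta> ^ (k * (p - 1))"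
proof -
  have "cnj \<zeta> * \<zeta> = 1"
    using norm_zeta by (simp add: mult.commute complex_norm_square flip: complex_norm_square)
  moreover have "\<zeta> ^ (p - 1) * \<zeta> = 1"
    using zeta_pow_p p_gt_1 by (simp flip: power_Suc2)
  ultimately have "cnj \<zeta> = \<zeta> ^ (p - 1)"
    by (metis mult_right_cancel mult_zero_right zero_neq_one)
  thus ?thesis by (simp add: mult.commute flip: power_mult)
qed

lemma zeta_power_cong: "[i = j] (mod p) \<Longrightarrow> \<zeta> ^ i = \<zeta> ^ j"
proof -
  have "\<zeta> ^ i = \<zeta> ^ (i mod p)" for i
    by (metis mod_mult_div_eq mult_1_right power_add power_mult power_one zeta_pow_p)
  thus "[i = j] (mod p) \<Longrightarrow> \<zeta> ^ i = \<zeta> ^ j" by (metis cong_def)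
qed

lemma a_mod: "a (i mod N) = a i"
  using period by (rule periodic_mod)

lemma a_cong: "[i = j] (mod N) \<Longrightarrow> a i = a j"
  by (metis a_mod cong_def)

lemma a_eq_0: "N dvd i \<Longrightarrow> a i = 0"
  using a_cong[of i 0] a_0 by (simp add: cong_0_iff)

lemma a_unit: "\<not> N dvd i \<Longrightarrow> norm (a i) = 1"
  using a_power norm_zeta by (metis norm_power power_one)

lemma a_eq_0_iff: "a i = 0 \<longleftrightarrow> N dvd i"
  using a_eq_0 a_unit by fastforce

lemma a_power_p: "\<not> N dvd i \<Longrightarrow> a i ^ p = 1"
  using a_power zeta_pow_p by (metis mult.commute power_mult power_one)

text \<open>Perfection says that the cyclic shifts of the sequence form an orthogonal basis.\<close>

lemma correlation:
  "(\<Sum>i<N. a (u + i) * cnj (a (v + i))) = (if [u = v] (mod N) then of_nat (N - 1) else 0)"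
proof -
  define d where "d = v + (N - 1) * u"
  have "u + d = v + u * N" using N_gt_2 by (cases N) (auto simp: d_def algebra_simps)
  hence ud: "[u + d = v] (mod N)" by (simp add: cong_def)
  have "a (v + i) = a ((i + u) + d)" for i
    using cong_add[OF cong_refl[of i] ud] by (intro a_cong) (simp add: cong_sym_eq add_ac)
  hence "(\<Sum>i<N. a (u + i) * cnj (a (v + i))) = (\<Sum>i<N. a (i + u) * cnj (a ((i + u) + d)))"
    by (simp add: add.commute)
  also have "\<dots> = autocorrelation N a d"
    unfolding autocorrelation_def
  proof (rule sum_shift_periodic)
    show "a (i + N) * cnj (a (i + N + d)) = a i * cnj (a (i + d))" for i
      using period[of i] period[of "i + d"] by (simp add: add_ac)
  qed
  finally have eq: "(\<Sum>i<N. a (u + i) * cnj (a (v + i))) = autocorrelation N a d" .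
  have dvd: "N dvd d \<longleftrightarrow> [u = v] (mod N)"
    using ud by (metis add.right_neutral cong_0_iff cong_add_lcancel_nat cong_sym cong_trans)
  show ?thesis
  proof (cases "N dvd d")
    case True
    have "a i * cnj (a (i + d)) = (if i = 0 then 0 else 1)" if "i < N" for i
    proof -
      have "a (i + d) = a i" using True by (intro a_cong) (auto simp: cong_def dvd_def)
      moreover have "N dvd i \<longleftrightarrow> i = 0" using that by (auto dest: dvd_imp_le)
      ultimately show ?thesis
        using a_unit[of i] a_eq_0[of i] by (auto simp flip: complex_norm_square)
    qed
    hence "autocorrelation N a d = (\<Sum>i<N. if i = 0 then 0 else 1)"
      unfolding autocorrelation_def by (intro sum.cong) auto
    also have "\<dots> = of_nat (card ({..<N} - {0}))"
      by (subst sum.mono_neutral_right[of _ "{..<N} - {0}"]) auto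
    also have "card ({..<N} - {0}) = N - 1" using N_gt_2 by simp
    finally show ?thesis using eq dvd True by simp
  qed (use eq dvd perfect in auto)
qed

section \<open>Divisibility of twisted correlations\<close>

text \<open>The ring \<open>\<int>[\<zeta>]\<close>.\<close>

definition cyclotomic_ints :: "complex set" where
  "cyclotomic_ints = range (\<lambda>q :: nat \<Rightarrow> int. \<Sum>j<p. of_int (q j) * \<zeta> ^ j)"

lemma cyclotomic_ints_0: "0 \<in> cyclotomic_ints"
  unfolding cyclotomic_ints_def by (rule image_eqI[of _ _ "\<lambda>_. 0"]) auto

lemma cyclotomic_ints_add:
  "x \<in> cyclotomic_ints \<Longrightarrow> y \<in> cyclotomic_ints \<Longrightarrow> x + y \<in> cyclotomic_ints"
proof -
  have "(\<Sum>j<p. of_int (q j) * \<zeta> ^ j) + (\<Sum>j<p. of_int (r j) * \<zeta> ^ j)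
      = (\<Sum>j<p. of_int (q j + r j) * \<zeta> ^ j)" for q r
    by (simp add: sum.distrib algebra_simps)
  thus "x \<in> cyclotomic_ints \<Longrightarrow> y \<in> cyclotomic_ints \<Longrightarrow> x + y \<in> cyclotomic_ints"
    unfolding cyclotomic_ints_def by fastforce
qed

lemma cyclotomic_ints_of_int_mult: "x \<in> cyclotomic_ints \<Longrightarrow> of_int c * x \<in> cyclotomic_ints"
proof -
  have "of_int c * (\<Sum>j<p. of_int (q j) * \<zeta> ^ j) = (\<Sum>j<p. of_int (c * q j) * \<zeta> ^ j)" for q
    by (simp add: sum_distrib_left mult_ac)
  thus "x \<in> cyclotomic_ints \<Longrightarrow> of_int c * x \<in> cyclotomic_ints"
    unfolding cyclotomic_ints_def by fastforce
qed

lemma cyclotomic_ints_sum: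
  "(\<And>i. i \<in> A \<Longrightarrow> f i \<in> cyclotomic_ints) \<Longrightarrow> sum f A \<in> cyclotomic_ints"
  by (induction A rule: infinite_finite_induct) (auto simp: cyclotomic_ints_0 cyclotomic_ints_add)

lemma zeta_power_in_cyclotomic_ints: "\<zeta> ^ k \<in> cyclotomic_ints"
proof -
  have "\<zeta> ^ k = \<zeta> ^ (k mod p)" by (rule zeta_power_cong) simp
  also have "\<dots> = (\<Sum>j<p. of_int (if j = k mod p then 1 else 0) * \<zeta> ^ j)"
    using p_gt_1 by (simp add: if_distrib[of of_int] if_distrib[of "\<lambda>c. c * _"] cong: if_cong)
  finally show ?thesis
    unfolding cyclotomic_ints_def
    by (rule image_eqI[of _ _ "\<lambda>j. if j = k mod p then 1 else 0"]) simp
qed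

text \<open>Correlation of \<open>a\<close> with its image under multiplication by \<open>t\<close>, which acts on values by
\<open>\<zeta> \<mapsto> \<zeta> ^ t\<close> and on indices by \<open>i \<mapsto> t * i\<close>.\<close>

definition twisted_correlation :: "nat \<Rightarrow> nat \<Rightarrow> complex" where
  "twisted_correlation t s = (\<Sum>i<N. a i ^ t * cnj (a (t * i + s)))"

text \<open>Encode the sequence as an integer polynomial \<open>P\<close>, the sum of the monomials \<open>X ^ c i\<close> with
\<open>c i\<close> congruent to \<open>i\<close> modulo \<open>N\<close> and to the exponent of \<open>a i\<close> modulo \<open>p\<close>, and give
\<open>X ^ k\<close> the weight \<open>\<zeta> ^ k * cnj (a (k + s))\<close>. Perfection makes the weight of every multiple of
\<open>P\<close> divisible by \<open>N - 1\<close>, in particular that of \<open>P ^ (r ^ e)\<close>. By the Frobenius congruence this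
power agrees modulo \<open>r\<close> with the sum of the \<open>X ^ (r ^ e * c i)\<close>, whose weight is the twisted
correlation.\<close>

lemma prime_divides_twisted_correlation:
  assumes r: "prime r" and r_dvd: "r dvd N - 1"
  shows "\<exists>z\<in>cyclotomic_ints. twisted_correlation (r ^ e) s = of_nat r * z"
proof -
  define t where "t = r ^ e"
  have t0: "t > 0" using r prime_gt_0_nat by (auto simp: t_def)
  have "\<exists>c. [c = i] (mod N) \<and> a i = \<zeta> ^ c" if "i \<in> {1..<N}" for i
  proof -
    have "\<not> N dvd i" using that by (auto dest: dvd_imp_le)
    then obtain k where k: "a i = \<zeta> ^ k" using a_power by blast
    obtain c where "[c = k] (mod p)" "[c = i] (mod N)"
      using binary_chinese_remainder_nat[OF coprime_p_N] by blast
    thus ?thesis using k zeta_power_cong by metis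
  qed
  then obtain c where c: "\<And>i. i \<in> {1..<N} \<Longrightarrow> [c i = i] (mod N)"
      "\<And>i. i \<in> {1..<N} \<Longrightarrow> a i = \<zeta> ^ c i"
    by metis
  define P :: "int poly" where "P = (\<Sum>i\<in>{1..<N}. monom 1 (c i))"
  define w where "w = (\<lambda>k. \<zeta> ^ k * cnj (a (k + s)))"
  have drop0: "(\<Sum>i<N. f i) = (\<Sum>i\<in>{1..<N}. f i)" if "f 0 = 0" for f :: "nat \<Rightarrow> complex"
    using that N_gt_2 by (intro sum.mono_neutral_right) (auto simp: not_less_eq_eq)
  have E: "weigh (\<Sum>i\<in>{1..<N}. monom 1 (c i) ^ t) w = twisted_correlation t s"
  proof -
    have "twisted_correlation t s = (\<Sum>i\<in>{1..<N}. a i ^ t * cnj (a (t * i + s)))"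
      unfolding twisted_correlation_def using t0 a_0 by (intro drop0) simp
    also have "\<dots> = (\<Sum>i\<in>{1..<N}. w (t * c i))"
    proof (intro sum.cong refl)
      fix i assume i: "i \<in> {1..<N}"
      have "a (t * i + s) = a (t * c i + s)"
        using c(1)[OF i] by (intro a_cong cong_add cong_mult cong_refl) (simp add: cong_sym)
      thus "a i ^ t * cnj (a (t * i + s)) = w (t * c i)"
        using c(2)[OF i] by (simp add: w_def mult.commute flip: power_mult)
    qed
    finally show ?thesis by (simp add: weigh_sum monom_power mult.commute)
  qed
  have PP: "\<exists>z\<in>cyclotomic_ints. weigh (P * g) w = of_nat r * z" for g
  proof -
    have P: "weigh P (\<lambda>j. w (j + k)) = \<zeta> ^ k * (if [0 = k + s] (mod N) then of_nat (N - 1) else 0)" for k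
    proof -
      have "weigh P (\<lambda>j. w (j + k)) = (\<Sum>i\<in>{1..<N}. w (c i + k))"
        by (simp add: P_def weigh_sum)
      also have "\<dots> = (\<Sum>i\<in>{1..<N}. \<zeta> ^ k * (a (0 + i) * cnj (a (k + s + i))))"
      proof (intro sum.cong refl)
        fix i assume i: "i \<in> {1..<N}"
        have "a (k + s + i) = a (c i + k + s)"
          using cong_add[OF cong_refl[of "k + s"] c(1)[OF i]]
          by (intro a_cong) (simp add: cong_sym_eq add_ac)
        thus "w (c i + k) = \<zeta> ^ k * (a (0 + i) * cnj (a (k + s + i)))"
          using c(2)[OF i] by (simp add: w_def power_add)
      qed
      also have "\<dots> = \<zeta> ^ k * (\<Sum>i<N. a (0 + i) * cnj (a (k + s + i)))"
        by (subst drop0) (auto simp: a_0 sum_distrib_left)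
      finally show ?thesis unfolding correlation .
    qed
    obtain n' where n': "N - 1 = r * n'" using r_dvd by blast
    define z where "z = (\<Sum>k\<le>degree g. of_int (coeff g k) *
       (if [0 = k + s] (mod N) then of_int (int n') * \<zeta> ^ k else 0))"
    have "weigh (P * g) w = of_nat r * z"
      unfolding weigh_mult P z_def sum_distrib_left n' by (intro sum.cong) auto
    moreover have "z \<in> cyclotomic_ints"
      unfolding z_def
      by (intro cyclotomic_ints_sum cyclotomic_ints_of_int_mult)
         (auto intro!: cyclotomic_ints_of_int_mult zeta_power_in_cyclotomic_ints cyclotomic_ints_0
               simp del: of_int_of_nat_eq)
    ultimately show ?thesis by blast
  qed
  have w: "w k \<in> cyclotomic_ints" for k
  proof (cases "N dvd k + s")
    case False
    then obtain l where "a (k + s) = \<zeta> ^ l" using a_power by blast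
    hence "w k = \<zeta> ^ (k + l * (p - 1))" by (simp only: w_def cnj_zeta_power power_add)
    thus ?thesis using zeta_power_in_cyclotomic_ints by simp
  qed (simp add: w_def a_eq_0 cyclotomic_ints_0)
  obtain Q where Q: "P ^ t - (\<Sum>i\<in>{1..<N}. monom 1 (c i) ^ t) = of_nat r * Q"
    using dvd_freshmans_dream_sum_power[OF r, of "\<lambda>i. monom 1 (c i) :: int poly" "{1..<N}" e]
    unfolding P_def t_def by auto
  have "weigh Q w \<in> cyclotomic_ints"
    unfolding weigh_def by (intro cyclotomic_ints_sum cyclotomic_ints_of_int_mult w)
  hence Qw: "of_int (- 1) * weigh Q w \<in> cyclotomic_ints"
    by (rule cyclotomic_ints_of_int_mult)
  \<comment> \<open>\<open>t\<close> is positive, so \<open>P ^ t\<close> is a multiple of \<open>P\<close>.\<close>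
  obtain z where z: "z \<in> cyclotomic_ints" "weigh (P ^ t) w = of_nat r * z"
    using PP[of "P ^ (t - 1)"] t0 by (metis power_eq_if less_numeral_extra(3))
  have "P ^ t = (\<Sum>i\<in>{1..<N}. monom 1 (c i) ^ t) + smult (int r) Q"
    using Q by (simp add: algebra_simps of_nat_poly)
  hence "weigh (P ^ t) w = twisted_correlation t s + of_nat r * weigh Q w"
    by (simp only: weigh_add weigh_smult E) simp
  hence "twisted_correlation t s = of_nat r * (z + of_int (- 1) * weigh Q w)"
    using z(2) by (simp add: algebra_simps)
  thus ?thesis using cyclotomic_ints_add[OF z(1) Qw] by (auto simp: t_def)
qed

lemma twisted_correlation_cong:
  assumes "[t = t'] (mod p * N)" "t > 0" "t' > 0"
  shows "twisted_correlation t s = twisted_correlation t' s"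
  unfolding twisted_correlation_def
proof (intro sum.cong refl)
  fix i
  have tp: "[t = t'] (mod p)" and tN: "[t = t'] (mod N)"
    using assms(1) cong_modulus_mult_nat[of t t' p N] cong_modulus_mult_nat[of t t' N p]
    by (simp_all add: mult.commute)
  have "a (t * i + s) = a (t' * i + s)"
    using tN by (intro a_cong cong_add cong_mult cong_refl)
  moreover have "a i ^ t = a i ^ t'"
  proof (cases "N dvd i")
    case False
    then obtain k where k: "a i = \<zeta> ^ k" using a_power by blast
    have "[k * t = k * t'] (mod p)" using tp by (intro cong_mult cong_refl)
    thus ?thesis unfolding k by (simp add: zeta_power_cong flip: power_mult)
  qed (use assms a_eq_0 in \<open>auto simp: power_0_left\<close>)
  ultimately show "a i ^ t * cnj (a (t * i + s)) = a i ^ t' * cnj (a (t' * i + s))" by simp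
qed

text \<open>Two of the \<open>N\<close> summands vanish: those where \<open>i\<close> or \<open>t * i + s\<close> is \<open>0\<close> modulo \<open>N\<close>. These are
different indices because \<open>s\<close> is nonzero modulo \<open>N\<close>.\<close>

lemma twisted_correlation_terms:
  assumes t: "coprime t N" "t > 0" and s: "\<not> N dvd s"
  obtains I :: "nat set" and e :: "nat \<Rightarrow> nat" where
    "twisted_correlation t s = (\<Sum>i\<in>I. \<zeta> ^ e i)" "finite I" "card I = N - 2"
proof -
  define h where "h = (\<lambda>i. (t * i + s) mod N)"
  have bij: "bij_betw h {..<N} {..<N}"
    unfolding h_def using bij_betw_affine_mod[OF t(1), of s] N_gt_2 by simp
  then obtain i0 where i0: "i0 < N" "h i0 = 0"
    using N_gt_2 by (auto simp: bij_betw_def image_iff Bex_def) (metis imageE lessThan_iff less_trans zero_less_numeral)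
  have uniq: "i = i0" if "i < N" "h i = 0" for i
    using bij that i0 by (auto simp: bij_betw_def inj_on_def)
  have "i0 \<noteq> 0"
    using i0(2) s by (intro notI) (auto simp: h_def)
  define I where "I = {..<N} - {0, i0}"
  have card: "card I = N - 2"
    unfolding I_def using i0 \<open>i0 \<noteq> 0\<close> N_gt_2 by (subst card_Diff_subset) auto
  have "\<exists>e. a i ^ t * cnj (a (t * i + s)) = \<zeta> ^ e" if "i \<in> I" for i
  proof -
    have "\<not> N dvd i" using that by (auto simp: I_def dest: dvd_imp_le)
    moreover have "\<not> N dvd t * i + s" using that uniq[of i] by (auto simp: I_def h_def)
    ultimately obtain k l where "a i = \<zeta> ^ k" "a (t * i + s) = \<zeta> ^ l" using a_power by meson
    thus ?thesis by (metis cnj_zeta_power power_add power_mult)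
  qed
  then obtain e where e: "\<And>i. i \<in> I \<Longrightarrow> a i ^ t * cnj (a (t * i + s)) = \<zeta> ^ e i" by metis
  have "a (t * i0 + s) = 0" using i0 by (intro a_eq_0) (auto simp: h_def)
  hence "twisted_correlation t s = (\<Sum>i\<in>I. a i ^ t * cnj (a (t * i + s)))"
    unfolding twisted_correlation_def using t a_0
    by (intro sum.mono_neutral_right) (auto simp: I_def)
  hence "twisted_correlation t s = (\<Sum>i\<in>I. \<zeta> ^ e i)" using e by simp
  moreover have "finite I" by (simp add: I_def)
  ultimately show ?thesis using card by (rule that)
qed

text \<open>Let \<open>F c\<close> be the number of summands equal to \<open>\<zeta> ^ c\<close>. Divisibility by \<open>r\<close> and the independence of
the powers of \<open>\<zeta>\<close> make all \<open>F c\<close> congruent modulo each \<open>r \<in> R\<close>, hence modulo \<open>\<Prod>R\<close>. They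
are nonnegative and their total \<open>N - 2\<close> is a multiple of \<open>p\<close> below \<open>p * \<Prod>R\<close>, so they are all
equal and the sum is a multiple of
\<open>1 + \<zeta> + \<dots> + \<zeta> ^ (p - 1) = 0\<close>.\<close>

lemma twisted_correlation_eq_0:
  assumes t: "coprime t N" "t > 0" and s: "\<not> N dvd s"
    and R: "finite R" "\<And>r. r \<in> R \<Longrightarrow> prime r" "\<And>r. r \<in> R \<Longrightarrow> r dvd N - 1"
    and power: "\<And>r. r \<in> R \<Longrightarrow> \<exists>e. [t = r ^ e] (mod p * N)"
    and large: "N - 2 < p * \<Prod>R"
  shows "twisted_correlation t s = 0"
proof -
  obtain I :: "nat set" and e :: "nat \<Rightarrow> nat" where I:
    "twisted_correlation t s = (\<Sum>i\<in>I. \<zeta> ^ e i)" "finite I" "card I = N - 2"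
    by (rule twisted_correlation_terms[OF t s])
  define F where "F = (\<lambda>c. card {i \<in> I. e i mod p = c})"
  have range: "(\<lambda>i. e i mod p) ` I \<subseteq> {..<p}" using p_gt_1 by auto
  have "(\<Sum>i\<in>I. \<zeta> ^ e i) = (\<Sum>i\<in>I. \<zeta> ^ (e i mod p))"
    by (intro sum.cong refl zeta_power_cong) (simp add: cong_def)
  also have "\<dots> = (\<Sum>c<p. \<Sum>i\<in>{i \<in> I. e i mod p = c}. \<zeta> ^ (e i mod p))"
    using I(2) range by (intro sum.group[symmetric]) auto
  also have "\<dots> = (\<Sum>c<p. of_nat (F c) * \<zeta> ^ c)"
    by (simp add: F_def)
  finally have E: "twisted_correlation t s = (\<Sum>c<p. of_nat (F c) * \<zeta> ^ c)" using I by simp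
  have "(\<Sum>c<p. F c) = (\<Sum>c<p. \<Sum>i\<in>{i \<in> I. e i mod p = c}. 1)" by (simp add: F_def)
  also have "\<dots> = (\<Sum>i\<in>I. 1)" using I(2) range by (intro sum.group) auto
  finally have sum_F: "(\<Sum>c<p. F c) = N - 2" using I by simp
  have cong_r: "[F c = F d] (mod r)" if r: "r \<in> R" and cd: "c < p" "d < p" for r c d
  proof -
    obtain k where k: "[t = r ^ k] (mod p * N)" using power[OF r] by blast
    have "r ^ k > 0" using R(2)[OF r] prime_gt_0_nat by auto
    with k t have "twisted_correlation t s = twisted_correlation (r ^ k) s"
      by (intro twisted_correlation_cong) auto
    also obtain q :: "nat \<Rightarrow> int" where
      "twisted_correlation (r ^ k) s = of_nat r * (\<Sum>c<p. of_int (q c) * \<zeta> ^ c)"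
      using prime_divides_twisted_correlation[OF R(2,3)[OF r]] by (auto simp: cyclotomic_ints_def)
    finally have "(\<Sum>c<p. of_int (int (F c) - int r * q c) * \<zeta> ^ c) = 0"
      unfolding E by (simp add: algebra_simps sum_subtractf sum_distrib_left)
    hence "int (F c) - int r * q c = int (F d) - int r * q d"
      by (rule root_of_unity_relation_const[OF prime_p zeta_pow_p zeta_neq_1 _ cd])
    hence "int (F c) - int (F d) = int r * (q c - q d)" by (simp add: algebra_simps)
    thus ?thesis by (auto simp: cong_iff_dvd_diff simp flip: cong_int_iff)
  qed
  have cong: "[F c = F d] (mod \<Prod>R)" if "c < p" "d < p" for c d
  proof (rule coprime_cong_prod_nat)
    show "\<And>i j. \<lbrakk>i \<in> R; j \<in> R; i \<noteq> j\<rbrakk> \<Longrightarrow> coprime i j" using R(2) primes_coprime by blast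
    show "\<And>r. r \<in> R \<Longrightarrow> [F c = F d] (mod r)" by (rule cong_r[OF _ that])
  qed
  have "\<not> p dvd \<Prod>R"
  proof
    assume "p dvd \<Prod>R"
    then obtain r where "r \<in> R" "p dvd r"
      using R(1) prime_p by (auto simp: prime_dvd_prod_iff)
    hence "p dvd N - 1" using R(3)[OF \<open>r \<in> R\<close>] dvd_trans by blast
    hence "p dvd (N - 1) - (N - 2)" using p_dvd by (rule dvd_diff_nat)
    thus False using N_gt_2 p_gt_1 by simp
  qed
  hence F_eq: "F c = F 0" if "c < p" for c
  proof (rule equal_of_cong_of_small_sum[OF prime_p _ cong])
    show "p dvd (\<Sum>c<p. F c)" "(\<Sum>c<p. F c) < p * \<Prod>R"
      unfolding sum_F by (fact p_dvd, fact large)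
  qed (use that p_gt_1 in auto)
  have "twisted_correlation t s = (\<Sum>c<p. of_nat (F 0) * \<zeta> ^ c)"
    unfolding E
  proof (intro sum.cong refl)
    fix c assume "c \<in> {..<p}"
    hence "F c = F 0" by (intro F_eq) simp
    thus "of_nat (F c) * \<zeta> ^ c = of_nat (F 0) * \<zeta> ^ c" by simp
  qed
  also have "\<dots> = of_nat (F 0) * (\<Sum>c<p. \<zeta> ^ c)" by (simp add: sum_distrib_left)
  also have "(\<Sum>c<p. \<zeta> ^ c) = 0" using zeta_neq_1 zeta_pow_p by (simp add: geometric_sum)
  finally show ?thesis by simp
qed

section \<open>The multiplier theorem and its consequences\<close>

text \<open>The image of \<open>a\<close> under the multiplier is orthogonal to all shifts of \<open>a\<close> but one. Since the shifts
form an orthogonal basis, it is a scalar multiple of the remaining one, which is \<open>a\<close> itself.\<close>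

theorem multiplier:
  assumes t: "coprime t N"
    and R: "finite R" "\<And>r. r \<in> R \<Longrightarrow> prime r" "\<And>r. r \<in> R \<Longrightarrow> r dvd N - 1"
    and power: "\<And>r. r \<in> R \<Longrightarrow> \<exists>e. [t = r ^ e] (mod p * N)"
    and large: "N - 2 < p * \<Prod>R"
  obtains \<kappa> where "\<kappa> \<noteq> 0" "\<And>j. a (t * j) = \<kappa> * a j ^ t"
proof -
  have t0: "t > 0" using t N_gt_2 by (cases t) auto
  let ?E = "twisted_correlation t"
  have main: "?E 0 * a (t * j) = of_nat (N - 1) * a j ^ t" for j
  proof -
    \<comment> \<open>Expand \<open>\<Sum>s<N. ?E s * a (t * j + s)\<close> twice: only \<open>s = 0\<close> contributes, and by
      orthogonality of the shifts only \<open>i = j\<close> contributes.\<close>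
    have "(\<Sum>s<N. ?E s * a (t * j + s)) = (\<Sum>s\<in>{0}. ?E s * a (t * j + s))"
    proof (intro sum.mono_neutral_right ballI)
      fix s assume "s \<in> {..<N} - {0}"
      hence "\<not> N dvd s" by (auto dest: dvd_imp_le)
      hence "?E s = 0" using twisted_correlation_eq_0[OF t t0 _ R power large] by blast
      thus "?E s * a (t * j + s) = 0" by simp
    qed (use N_gt_2 in auto)
    hence "?E 0 * a (t * j) = (\<Sum>s<N. ?E s * a (t * j + s))" by simp
    also have "\<dots> = (\<Sum>s<N. \<Sum>i<N. a i ^ t * (a (t * j + s) * cnj (a (t * i + s))))"
      by (simp add: twisted_correlation_def sum_distrib_left sum_distrib_right mult_ac)
    also have "\<dots> = (\<Sum>i<N. a i ^ t * (\<Sum>s<N. a (t * j + s) * cnj (a (t * i + s))))"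
      by (subst sum.swap) (simp add: sum_distrib_left)
    also have "\<dots> = (\<Sum>i<N. if i = j mod N then a i ^ t * of_nat (N - 1) else 0)"
    proof (intro sum.cong refl)
      fix i assume "i \<in> {..<N}"
      moreover have "[t * j = t * i] (mod N) \<longleftrightarrow> [j = i] (mod N)"
        using t by (simp add: cong_mult_lcancel_nat)
      ultimately show "a i ^ t * (\<Sum>s<N. a (t * j + s) * cnj (a (t * i + s)))
          = (if i = j mod N then a i ^ t * of_nat (N - 1) else 0)"
        unfolding correlation by (auto simp: cong_def)
    qed
    also have "\<dots> = of_nat (N - 1) * a j ^ t"
      using N_gt_2 by (simp add: a_mod)
    finally show ?thesis .
  qed
  have "a 1 \<noteq> 0" using N_gt_2 by (simp add: a_eq_0_iff)
  hence E0: "?E 0 \<noteq> 0" using main[of 1] N_gt_2 by auto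
  show ?thesis
  proof (rule that)
    show "of_nat (N - 1) / ?E 0 \<noteq> 0" using E0 N_gt_2 by simp
    show "a (t * j) = of_nat (N - 1) / ?E 0 * a j ^ t" for j
      using main[of j] E0 by (simp add: field_simps)
  qed
qed

text \<open>If all nonzero terms were equal to \<open>\<alpha>\<close>, the correlation at shift \<open>1\<close> would consist of \<open>N - 2\<close> terms
equal to \<open>\<alpha> * cnj \<alpha> = 1\<close>.\<close>

lemma not_constant:
  assumes "\<And>j. \<not> N dvd j \<Longrightarrow> a j = \<alpha>"
  shows False
proof -
  have I: "i = 0 \<or> i = N - 1 \<or> (\<not> N dvd i \<and> \<not> N dvd i + 1)" if "i < N" for i
  proof (cases "i = 0 \<or> i = N - 1")
    case False
    hence "0 < i" "i + 1 < N" using that by auto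
    thus ?thesis by (auto dest: dvd_imp_le)
  qed auto
  have "norm \<alpha> = 1" using a_unit[of 1] assms[of 1] N_gt_2 by simp
  hence \<alpha>: "\<alpha> * cnj \<alpha> = 1" by (simp flip: complex_norm_square)
  have "autocorrelation N a 1 = (\<Sum>i\<in>{..<N} - {0, N - 1}. \<alpha> * cnj \<alpha>)"
    unfolding autocorrelation_def
  proof (rule sum.mono_neutral_cong_right)
    show "\<forall>i\<in>{..<N} - ({..<N} - {0, N - 1}). a i * cnj (a (i + 1)) = 0"
      using a_0 a_eq_0[of N] N_gt_2 by auto
    show "a i * cnj (a (i + 1)) = \<alpha> * cnj \<alpha>" if "i \<in> {..<N} - {0, N - 1}" for i
      using I[of i] that assms by auto
  qed auto
  also have "\<dots> = of_nat (card ({..<N} - {0, N - 1}))" by (simp add: \<alpha>)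
  also have "card ({..<N} - {0, N - 1}) = N - 2"
    using N_gt_2 by (subst card_Diff_subset) auto
  finally have "of_nat (N - 2) = (0 :: complex)" using perfect[of 1] N_gt_2 by simp
  thus False using N_gt_2 by (simp only: of_nat_eq_0_iff)
qed

text \<open>Iterating \<open>L\<close> times fixes every index, so \<open>a j ^ (t ^ L - 1)\<close> is the same for all nonzero \<open>j\<close>. As
\<open>t ^ L - 1\<close> is invertible modulo \<open>p\<close>, already \<open>a j\<close> is the same for all nonzero \<open>j\<close>.\<close>

theorem no_multiplier_of_wrong_order:
  assumes t: "\<kappa> \<noteq> 0" "\<And>j. a (t * j) = \<kappa> * a j ^ t"
    and L: "[t ^ L = 1] (mod N)" and order: "\<not> [t ^ L = 1] (mod p)"
  shows False
proof -
  have "\<exists>\<mu>. \<mu> \<noteq> 0 \<and> (\<forall>j. a (t ^ l * j) = \<mu> * a j ^ (t ^ l))" for l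
  proof (induction l)
    case (Suc l)
    then obtain \<mu> where \<mu>: "\<mu> \<noteq> 0" "\<And>j. a (t ^ l * j) = \<mu> * a j ^ (t ^ l)" by blast
    have "a (t ^ Suc l * j) = (\<kappa> * \<mu> ^ t) * a j ^ (t ^ Suc l)" for j
      using t(2)[of "t ^ l * j"] \<mu>(2)[of j]
      by (simp add: mult.assoc power_mult_distrib mult.commute[of t] flip: power_mult)
    moreover have "\<kappa> * \<mu> ^ t \<noteq> 0" using t \<mu> by simp
    ultimately show ?case by blast
  qed (auto intro!: exI[of _ 1])
  then obtain \<mu> where \<mu>: "\<mu> \<noteq> 0" "\<And>j. a (t ^ L * j) = \<mu> * a j ^ (t ^ L)" by blast
  have fix_j: "a j = \<mu> * a j ^ (t ^ L)" for j
    using \<mu>(2)[of j] a_cong[OF cong_mult[OF L cong_refl[of j]]] by simp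
  have "t ^ L \<noteq> 0" using L N_gt_2 by (intro notI) (simp add: cong_def)
  define m where "m = t ^ L - 1"
  have tL: "t ^ L = m + 1" using \<open>t ^ L \<noteq> 0\<close> by (simp add: m_def)
  hence "\<not> p dvd m" using order by (metis add_0 cong_0_iff cong_add_rcancel_nat)
  then obtain u where u: "[m * u = 1] (mod p)"
    using cong_solve_coprime_nat[of m p] prime_imp_coprime[OF prime_p] by (auto simp: coprime_commute)
  have "a j = (1 / \<mu>) ^ u" if j: "\<not> N dvd j" for j
  proof -
    obtain k where k: "a j = \<zeta> ^ k" using a_power[OF j] by blast
    have "a j = \<mu> * a j ^ m * a j"
      using fix_j[of j] by (simp add: tL mult_ac)
    hence "\<mu> * a j ^ m = 1" using j a_eq_0_iff[of j] by simp
    hence "a j ^ m = 1 / \<mu>" using \<mu>(1) by (simp add: field_simps)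
    hence "(1 / \<mu>) ^ u = (a j ^ m) ^ u" by simp
    also have "\<dots> = \<zeta> ^ (k * (m * u))" by (simp add: k mult.assoc flip: power_mult)
    also have "\<dots> = \<zeta> ^ (k * 1)" using u by (intro zeta_power_cong cong_mult cong_refl)
    finally show ?thesis by (simp add: k)
  qed
  thus False using not_constant by blast
qed

section \<open>Sums along an arithmetic progression\<close>

text \<open>Summing the sequence along the classes modulo \<open>v\<close> gives a sequence of period \<open>v\<close> that inherits the
perfect correlation; its correlation at shift \<open>0\<close> is the original one, \<open>N - 1\<close>.\<close>

lemma sum_progression_norm_squares:
  assumes N: "N = v * w"
  shows "(\<Sum>u<v. (norm (\<Sum>k<w. a (u + v * k)))\<^sup>2) = real (N - 1)"
proof -
  define S where "S = (\<lambda>u. \<Sum>k<w. a (u + v * k))"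
  have v0: "v > 0" and w0: "w > 0" using N N_gt_2 by (cases v; cases w; simp)+
  have S_shift: "S (u + v * k) = S u" for u k
  proof -
    have "S (u + v * k) = (\<Sum>l<w. a (u + v * (l + k)))" by (simp add: S_def algebra_simps)
    also have "\<dots> = S u"
      unfolding S_def
    proof (rule sum_shift_periodic)
      show "a (u + v * (i + w)) = a (u + v * i)" for i
        using period[of "u + v * i"] by (simp add: N algebra_simps)
    qed
    finally show ?thesis .
  qed
  \<comment> \<open>Every \<open>i < N\<close> is \<open>u + v * k\<close> for exactly one pair \<open>u < v\<close>, \<open>k < w\<close>.\<close>
  have regroup: "(\<Sum>u<v. \<Sum>k<w. f (u + v * k)) = (\<Sum>i<N. f i)" for f :: "nat \<Rightarrow> complex"
    unfolding sum.cartesian_product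
  proof (rule sum.reindex_bij_witness[of _ "\<lambda>i. (i mod v, i div v)" "\<lambda>(u, k). u + v * k"])
    fix x assume x: "x \<in> {..<v} \<times> {..<w}"
    obtain u k where [simp]: "x = (u, k)" by (cases x)
    have uk: "u < v" "k < w" using x by auto
    have "u + v * k < v * Suc k" using uk by simp
    also have "\<dots> \<le> v * w" using uk by (intro mult_le_mono2) simp
    finally show "(case x of (u, k) \<Rightarrow> u + v * k) \<in> {..<N}" by (simp add: N)
  qed (use v0 in \<open>auto simp: N less_mult_imp_div_less mult.commute\<close>)
  have "(\<Sum>u<v. S u * cnj (S u)) = (\<Sum>u<v. \<Sum>k<w. a (u + v * k) * cnj (S (u + v * k)))"
    by (simp only: S_shift) (simp add: S_def sum_distrib_right)
  also have "\<dots> = (\<Sum>i<N. a i * cnj (S i))" by (rule regroup)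
  also have "\<dots> = (\<Sum>k<w. \<Sum>i<N. a (0 + i) * cnj (a (v * k + i)))"
    unfolding S_def by (subst sum.swap) (simp add: sum_distrib_left add.commute)
  also have "\<dots> = (\<Sum>k\<in>{0}. \<Sum>i<N. a (0 + i) * cnj (a (v * k + i)))"
  proof (intro sum.mono_neutral_right ballI)
    fix k assume "k \<in> {..<w} - {0}"
    hence "0 < v * k" "v * k < N" using v0 by (auto simp: N)
    hence "\<not> [0 = v * k] (mod N)" by (simp add: cong_def)
    thus "(\<Sum>i<N. a (0 + i) * cnj (a (v * k + i))) = 0" unfolding correlation by simp
  qed (use w0 in auto)
  also have "\<dots> = of_nat (N - 1)" using correlation[of 0 0] by simp
  finally have "(\<Sum>u<v. S u * cnj (S u)) = of_nat (N - 1)" .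
  hence "complex_of_real (\<Sum>u<v. (norm (S u))\<^sup>2) = of_real (real (N - 1))"
    by (simp only: of_real_sum complex_norm_square of_real_of_nat_eq)
  thus ?thesis unfolding of_real_eq_iff S_def .
qed

end

section \<open>The four parameter pairs\<close>

lemma almost_ary_perfect_imp_locale:
  assumes "almost_ary_sequence p N a" "perfect_sequence N a"
    and "prime p" "N > 2" "p dvd N - 2" "coprime p N"
  obtains \<zeta> where "perfect_almost_ary p N \<zeta> a"
proof -
  obtain \<zeta> where \<zeta>: "primitive_root_of_unity p \<zeta>" "\<And>i. i \<in> {1..<N} \<Longrightarrow> \<exists>k. a i = \<zeta> ^ k"
    and per: "\<And>i. a (i + N) = a i" and a0: "a 0 = 0"
    using assms(1) unfolding almost_ary_sequence_def by blast
  have mod: "i mod N \<in> {1..<N}" if "\<not> N dvd i" for i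
    using that \<open>N > 2\<close> mod_eq_0_iff_dvd[of i N] by (auto simp: Suc_le_eq)
  have ac_per: "autocorrelation N a (s + N) = autocorrelation N a s" for s
  proof -
    have "a (i + (s + N)) = a (i + s)" for i using per[of "i + s"] by (simp add: add_ac)
    thus ?thesis unfolding autocorrelation_def by simp
  qed
  have "perfect_almost_ary p N \<zeta> a"
  proof
    show "\<zeta> ^ p = 1" using \<zeta>(1) by (simp add: primitive_root_of_unity_def)
    have "\<zeta> ^ 1 \<noteq> 1"
      using \<zeta>(1) prime_gt_1_nat[OF \<open>prime p\<close>] unfolding primitive_root_of_unity_def by blast
    thus "\<zeta> \<noteq> 1" by simp
    show "\<exists>k. a i = \<zeta> ^ k" if "\<not> N dvd i" for i
      using \<zeta>(2)[OF mod[OF that]] periodic_mod[of a N i, OF per] by simp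
    show "autocorrelation N a s = 0" if "\<not> N dvd s" for s
      using assms(2) mod[OF that] periodic_mod[of "autocorrelation N a" N s, OF ac_per]
      by (simp add: perfect_sequence_def)
  qed (use assms per a0 in auto)
  thus ?thesis using that by blast
qed

text \<open>If \<open>x \<noteq> y\<close>, then \<open>x\<^sup>2 + x * y + y\<^sup>2 = 0\<close>, that is \<open>(x + y)\<^sup>2 = x * y\<close>.\<close>

lemma norm_sum_cube_roots_of_unity:
  fixes x y :: complex
  assumes "x ^ 3 = 1" "y ^ 3 = 1"
  shows "norm (x + y) \<ge> 1"
proof -
  have x: "norm x = 1" and y: "norm y = 1"
    using assms power_eq_imp_eq_base[of "norm x" 3 1] power_eq_imp_eq_base[of "norm y" 3 1]
    by (simp_all flip: norm_power)
  have "(x - y) * (x\<^sup>2 + x * y + y\<^sup>2) = 0"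
    using assms by (simp add: algebra_simps power2_eq_square power3_eq_cube)
  then consider "x = y" | "x\<^sup>2 + x * y + y\<^sup>2 = 0" by auto
  thus ?thesis
  proof cases
    case 1
    hence "norm (x + y) = 2" using x by (simp flip: mult_2 add: norm_mult)
    thus ?thesis by simp
  next
    case 2
    have "(x + y)\<^sup>2 = (x\<^sup>2 + x * y + y\<^sup>2) + x * y" by (simp add: power2_eq_square algebra_simps)
    hence "norm (x + y) ^ 2 = norm (x * y)" unfolding 2 by (simp flip: norm_power)
    hence "norm (x + y) = 1" using x y power_eq_imp_eq_base[of "norm (x + y)" 2 1] by (simp add: norm_mult)
    thus ?thesis by simp
  qed
qed

text \<open>Neither prime factor of \<open>91 = 7 * 13\<close> is large enough alone, but
\<open>49\<close> is a power of both modulo \<open>276 = 3 * 92\<close>. Being \<open>1\<close> modulo \<open>3\<close>, it acts trivially on the values,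
so \<open>a (49 * j) = a j\<close>. On the nonzero multiples \<open>4 * k\<close> of \<open>4\<close> modulo \<open>92\<close> it acts as \<open>k \<mapsto> 3 * k\<close> modulo
\<open>23\<close>, with two orbits of length \<open>11\<close>. So the sum of \<open>a\<close> over these indices is \<open>11\<close> times a
sum of two cube roots of unity and has squared norm at least \<open>121\<close>, whereas the squared norms of
the sums over the four classes modulo \<open>4\<close> add up to \<open>91\<close>.\<close>

lemma no_perfect_almost_ternary_92: "\<not> perfect_almost_ary 3 92 \<zeta> a"
proof
  assume "perfect_almost_ary 3 92 \<zeta> a"
  then interpret perfect_almost_ary 3 92 \<zeta> a .
  obtain \<kappa> where \<kappa>: "\<And>j. a (49 * j) = \<kappa> * a j ^ 49"
  proof (rule multiplier[of 49 "{7, 13}"])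
    show "prime r" if "r \<in> {7, 13}" for r :: nat using that by auto
    show "\<exists>e. [49 = r ^ e] (mod 3 * 92)" if "r \<in> {7, 13}" for r :: nat
    proof -
      have "[49 = 7 ^ 2] (mod 3 * 92 :: nat)" "[49 = 13 ^ 9] (mod 3 * 92 :: nat)"
        by (simp_all add: cong_def)
      thus ?thesis using that by (metis empty_iff insert_iff)
    qed
    have "coprime ((7 :: nat) ^ 2) 92"
      using prime_imp_coprime[of "7 :: nat" 92] unfolding coprime_power_left_iff by auto
    thus "coprime (49 :: nat) 92" by simp
  qed auto
  have pow: "a j ^ 49 = a j" for j
  proof (cases "92 dvd j")
    case False
    have "a j ^ 49 = (a j ^ 3) ^ 16 * a j" by (simp flip: power_mult power_Suc2)
    thus ?thesis using a_power_p[OF False] by simp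
  qed (simp add: a_eq_0)
  \<comment> \<open>The index \<open>23\<close> is fixed by \<open>49\<close>, which determines the scalar.\<close>
  have "a (49 * 23) = a 23" by (rule a_cong) (simp add: cong_def)
  hence "\<kappa> = 1" using \<kappa>[of 23] a_eq_0_iff[of 23] by (simp add: pow)
  hence step: "a (49 * j mod 92) = a j" for j using \<kappa>[of j] by (simp add: pow a_mod)
  \<comment> \<open>Ten steps along each orbit suffice to rewrite all its terms to \<open>a 4\<close> or \<open>a 20\<close>; an eleventh
    would close the cycle.\<close>
  note orbit1 = step[of 4] step[of 12] step[of 36] step[of 16] step[of 48] step[of 52]
    step[of 64] step[of 8] step[of 24] step[of 72]
  note orbit2 = step[of 20] step[of 60] step[of 88] step[of 80] step[of 56] step[of 76]
    step[of 44] step[of 40] step[of 28] step[of 84]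
  have "(\<Sum>k<23. a (0 + 4 * k)) = 11 * (a 4 + a 20)"
    using orbit1 orbit2 a_0 by (simp add: lessThan_nat_numeral lessThan_Suc)
  moreover have "norm (a 4 + a 20) \<ge> 1"
    using a_power_p[of 4] a_power_p[of 20] by (intro norm_sum_cube_roots_of_unity) auto
  ultimately have "norm (\<Sum>k<23. a (0 + 4 * k)) \<ge> 11" by (simp only: norm_mult) simp
  hence "11\<^sup>2 \<le> (norm (\<Sum>k<23. a (0 + 4 * k)))\<^sup>2" by (intro power_mono) auto
  also have "\<dots> \<le> (\<Sum>u<4. (norm (\<Sum>k<23. a (u + 4 * k)))\<^sup>2)"
    by (rule member_le_sum) auto
  also have "\<dots> = 91" using sum_progression_norm_squares[of 4 23] by simp
  finally show False by simp
qed

text \<open>The prime \<open>r\<close> is itself a multiplier, and \<open>L\<close> is a multiple of its order modulo \<open>N\<close> but not of its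
order modulo \<open>p\<close>.\<close>

lemma no_perfect_almost_ary_of_prime_multiplier:
  assumes "prime r" "r dvd N - 1" "N - 2 < p * r"
    and "[r ^ L = 1] (mod N)" "\<not> [r ^ L = 1] (mod p)"
  shows "\<not> perfect_almost_ary p N \<zeta> a"
proof
  assume "perfect_almost_ary p N \<zeta> a"
  then interpret perfect_almost_ary p N \<zeta> a .
  have "\<not> r dvd N"
  proof
    assume "r dvd N"
    hence "r dvd N - (N - 1)" using \<open>r dvd N - 1\<close> by (rule dvd_diff_nat)
    thus False using N_gt_2 \<open>prime r\<close> by simp
  qed
  hence "coprime r N" using \<open>prime r\<close> by (rule prime_imp_coprime[rotated])
  obtain \<kappa> where "\<kappa> \<noteq> 0" "\<And>j. a (r * j) = \<kappa> * a j ^ r"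
  proof (rule multiplier[of r "{r}"])
    show "\<exists>e. [r = q ^ e] (mod p * N)" if "q \<in> {r}" for q
      using that by (intro exI[of _ 1]) simp
  qed (use assms \<open>coprime r N\<close> in auto)
  thus False using no_multiplier_of_wrong_order assms by blast
qed

theorem theorem5:
  fixes n p :: nat
  assumes "(n, p) \<in> {(63, 31), (91, 3), (92, 7), (93, 23)}"
  shows "\<not> (\<exists>a. almost_ary_sequence p (n + 1) a \<and> perfect_sequence (n + 1) a)"
proof
  assume "\<exists>a. almost_ary_sequence p (n + 1) a \<and> perfect_sequence (n + 1) a"
  then obtain a where a: "almost_ary_sequence p (n + 1) a" "perfect_sequence (n + 1) a" by blast
  have primes: "prime (31 :: nat)" "prime (3 :: nat)" "prime (7 :: nat)" "prime (23 :: nat)" by simp_all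
  have "prime p \<and> n + 1 > 2 \<and> p dvd n + 1 - 2 \<and> coprime p (n + 1)"
    using assms primes by (auto intro!: prime_imp_coprime)
  then obtain \<zeta> where \<zeta>: "perfect_almost_ary p (n + 1) \<zeta> a"
    using almost_ary_perfect_imp_locale[OF a] by blast
  from assms consider "n = 63" "p = 31" | "n = 91" "p = 3" | "n = 92" "p = 7" | "n = 93" "p = 23"
    by auto
  thus False
  proof cases
    case 1
    thus False
      using \<zeta> no_perfect_almost_ary_of_prime_multiplier[of 3 64 31 16 \<zeta> a]
      by (simp add: cong_def)
  next
    case 2
    thus False using \<zeta> no_perfect_almost_ternary_92[of \<zeta> a] by simp
  next
    case 3
    thus False
      using \<zeta> no_perfect_almost_ary_of_prime_multiplier[of 23 93 7 10 \<zeta> a]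
      by (simp add: cong_def)
  next
    case 4
    thus False
      using \<zeta> no_perfect_almost_ary_of_prime_multiplier[of 31 94 23 46 \<zeta> a]
      by (simp add: cong_def)
  qed
qed

end
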